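(* Let $X\subseteq\mathbb{N}^2$ and suppose that for each $n$ the directed graph $G_n(X)$ is a tournament. Then \[ d_X(\emptyset;n)=\sum_{w}2^{\mathrm{nsc}(w)}, \] where the sum ranges over all $w\in\mathfrak{S}_n$ of odd order (all cycle lengths odd) such that every nontrivial cycle of $w$ is a directed cycle of $\overline{G_n(X)}$.
   Context: $[n]=\{1,\dots,n\}$. For $\pi=\pi_1\cdots\pi_n\in\mathfrak{S}_n$, $\mathrm{XDes}(\pi)=\{i\in[n-1]:(\pi_i,\pi_{i+1})\in X\}$; $d_X(\emptyset;n)$ is the number of $\pi\in\mathfrak{S}_n$ with $\mathrm{XDes}(\pi)=\emptyset$. $G_n(X)$ is the digraph on $[n]$ with an edge $i\to j$ iff $i\ne j$ and $(i,j)\notin X$. A tournament is a digraph in which for every two distinct vertices $i,j$ exactly one of $i\to j$, $j\to i$ is an edge; $\overline{D}$ is the tournament obtained from $D$ by reversing all edges. $\mathrm{nsc}(w)$ is the number of nontrivial (length $\ge2$) cycles in the disjoint cycle decomposition of $w$. A cycle $(v_1\,v_2\cdots v_k)$ of $w$ (so $w(v_i)=v_{i+1}$, indices mod $k$) is a directed cycle of a digraph $D$ if $v_i\to v_{i+1}$ is an edge of $D$ for all $i$ (indices mod $k$). *)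

theory Defs
  imports
    "HOL-Combinatorics.Permutations"
    "HOL-Algebra.Sym_Groups"
    "HOL-Algebra.Multiplicative_Group"
    "Graph_Theory.Pair_Digraph"
begin

definition XDes :: "(nat \<times> nat) set \<Rightarrow> nat \<Rightarrow> (nat \<Rightarrow> nat) \<Rightarrow> nat set" where
  "XDes X n p = {i \<in> {1..n - 1}. (p i, p (i + 1)) \<in> X}"

definition d_num :: "(nat \<times> nat) set \<Rightarrow> nat set \<Rightarrow> nat \<Rightarrow> nat" where
  "d_num X S n = card {p. p permutes {1..n} \<and> XDes X n p = S}"

definition G_digraph :: "nat \<Rightarrow> (nat \<times> nat) set \<Rightarrow> nat pair_pre_digraph" where
  "G_digraph n X =
    \<lparr> pverts = {1..n},
      parcs = {(i, j). i \<in> {1..n} \<and> j \<in> {1..n} \<and> i \<noteq> j \<and> (i, j) \<notin> X} \<rparr>"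

definition tournament :: "'a pair_pre_digraph \<Rightarrow> bool" where
  "tournament D \<longleftrightarrow> pair_wf_digraph D \<and>
    (\<forall>i \<in> pverts D. \<forall>j \<in> pverts D. i \<noteq> j \<longrightarrow>
      ((i, j) \<in> parcs D \<and> (j, i) \<notin> parcs D) \<or> ((i, j) \<notin> parcs D \<and> (j, i) \<in> parcs D))"

definition reverse_digraph :: "'a pair_pre_digraph \<Rightarrow> 'a pair_pre_digraph" where
  "reverse_digraph D = D\<lparr> parcs := (parcs D)\<inverse> \<rparr>"

text \<open>A cycle $(v_1\,v_2 \cdots v_k)$ is represented by the list of its entries. The $k$ cyclic
  rotations of such a list denote the same cycle; cycles are identified by their sets of entries
  when they are counted.\<close>

definition perm_cycle :: "('a \<Rightarrow> 'a) \<Rightarrow> 'a list \<Rightarrow> bool" where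
  "perm_cycle w vs \<longleftrightarrow> vs \<noteq> [] \<and> distinct vs \<and>
    (\<forall>i < length vs. w (vs ! i) = vs ! ((i + 1) mod length vs))"

definition nontrivial_cycle :: "('a \<Rightarrow> 'a) \<Rightarrow> 'a list \<Rightarrow> bool" where
  "nontrivial_cycle w vs \<longleftrightarrow> perm_cycle w vs \<and> length vs \<ge> 2"

definition nsc :: "('a \<Rightarrow> 'a) \<Rightarrow> nat" where
  "nsc w = card {set vs | vs. nontrivial_cycle w vs}"

definition directed_cycle :: "'a pair_pre_digraph \<Rightarrow> 'a list \<Rightarrow> bool" where
  "directed_cycle D vs \<longleftrightarrow> vs \<noteq> [] \<and> distinct vs \<and>
    (\<forall>i < length vs. (vs ! i, vs ! ((i + 1) mod length vs)) \<in> parcs D)"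

definition odd_order :: "nat \<Rightarrow> (nat \<Rightarrow> nat) \<Rightarrow> bool" where
  "odd_order n w \<longleftrightarrow> odd (group.ord (sym_group n) w)"

lemma sym_group_nat_pow: "w [^]\<^bsub>sym_group n\<^esub> (k::nat) = w ^^ k"
  by (induction k) (simp_all add: sym_group_one sym_group_mult nat_pow_def funpow_swap1 fun_eq_iff)

lemma perm_cycle_funpow:
  assumes "perm_cycle w vs" "i < length vs"
  shows "(w ^^ k) (vs ! i) = vs ! ((i + k) mod length vs)"
proof (induction k)
  case 0
  then show ?case using assms by simp
next
  case (Suc k)
  have "(i + k) mod length vs < length vs" using assms by (intro mod_less_divisor) auto
  then have "w (vs ! ((i + k) mod length vs)) = vs ! (((i + k) mod length vs + 1) mod length vs)"
    using assms(1) unfolding perm_cycle_def by blast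
  then show ?case using Suc by (simp add: mod_Suc_eq)
qed

lemma perm_cycle_support:
  assumes "permutation w"
  shows "perm_cycle w (support w x)"
proof -
  let ?L = "least_power w x"
  have L: "(w ^^ ?L) x = x" "?L > 0"
    using least_power_of_permutation[OF assms] by auto
  have "w ((w ^^ i) x) = (w ^^ ((i + 1) mod ?L)) x" if "i < ?L" for i
  proof (cases "i + 1 = ?L")
    case True
    then have "w ((w ^^ i) x) = (w ^^ ?L) x" by (metis Suc_eq_plus1 comp_apply funpow.simps(2))
    then show ?thesis using True L by simp
  next
    case False
    then show ?thesis using that by simp
  qed
  then show ?thesis
    using L cycle_of_permutation[OF assms] by (auto simp: perm_cycle_def)
qed

lemma odd_order_iff_cycle_lengths:
  assumes w: "w permutes {1..n}"
  shows "odd_order n w \<longleftrightarrow> (\<forall>vs. perm_cycle w vs \<longrightarrow> odd (length vs))"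
proof
  interpret group "sym_group n" by (rule sym_group_is_group)
  have wc: "w \<in> carrier (sym_group n)" using w by (simp add: sym_group_carrier)
  have pow: "w ^^ k = id \<longleftrightarrow> ord w dvd k" for k
    using pow_eq_id[OF wc, of k] by (simp add: sym_group_nat_pow sym_group_one)
  {
    assume odd: "odd_order n w"
    show "\<forall>vs. perm_cycle w vs \<longrightarrow> odd (length vs)"
    proof (intro allI impI)
      fix vs assume vs: "perm_cycle w vs"
      then have "0 < length vs" "distinct vs" by (auto simp: perm_cycle_def)
      moreover have "vs ! (ord w mod length vs) = vs ! 0"
        using perm_cycle_funpow[OF vs \<open>0 < length vs\<close>, of "ord w"] pow[of "ord w"] by simp
      ultimately have "ord w mod length vs = 0"
        by (metis mod_less_divisor nth_eq_iff_index_eq)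
      then show "odd (length vs)"
        using odd unfolding odd_order_def by (meson dvd_trans mod_0_imp_dvd)
    qed
  next
    assume odd: "\<forall>vs. perm_cycle w vs \<longrightarrow> odd (length vs)"
    have pm: "permutation w" using w permutation_permutes by blast
    define m where "m = (\<Prod>x \<in> {1..n}. least_power w x)"
    have "odd (least_power w x)" for x
      using odd perm_cycle_support[OF pm, of x] by fastforce
    then have "odd m" unfolding m_def by (simp add: even_prod_iff)
    have "(w ^^ m) x = x" for x
    proof (cases "x \<in> {1..n}")
      case True
      then have "least_power w x dvd m" unfolding m_def by (intro dvd_prodI) auto
      then show ?thesis using least_power_dvd[OF pm] by blast
    next
      case False
      then have "w x = x" using w by (simp add: permutes_not_in)
      then show ?thesis by (induction m) auto
    qed
    then have "w ^^ m = id" by (simp add: fun_eq_iff)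
    then have "ord w dvd m" using pow by blast
    then show "odd_order n w" using \<open>odd m\<close> unfolding odd_order_def by (meson dvd_trans)
  }
qed

end

theory Submission
  imports
    Defs
    "HOL-Combinatorics.Multiset_Permutations"
    "HOL-Combinatorics.Orbits"
begin

text \<open>
  Write \<open>B\<close> for the arcs of the reversed tournament; the permutations counted on the left are the
  linear orders no two consecutive entries of which form an arc of \<open>B\<close>. By inclusion-exclusion their
  number is the sum, over the acyclic sets \<open>P\<close> of arcs of \<open>B\<close>, of \<open>(-1)^|P|\<close> times the number of
  linear orders in which every arc of \<open>P\<close> is consecutive. For acyclic \<open>P\<close> there are equally many
  permutations \<open>w\<close> of the vertices with \<open>w x = y\<close> for all \<open>(x, y) \<in> P\<close>. Exchanging the sums, each
  \<open>w\<close> contributes a product over its cycles: a cycle of length \<open>k\<close> gives \<open>(-1)^(k-1)\<close> if all its arcs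
  are in \<open>B\<close>, \<open>1\<close> if none is, and \<open>0\<close> otherwise. In a tournament, reversing a nontrivial cycle
  exchanges the first two cases, so the two orientations of a cycle together contribute \<open>0\<close> if \<open>k\<close> is
  even and \<open>2\<close> if \<open>k\<close> is odd.
\<close>

section \<open>Consecutive pairs of a list\<close>

fun consec :: "'a list \<Rightarrow> ('a \<times> 'a) set" where
  "consec [] = {}"
| "consec (x # xs) = (if xs = [] then {} else insert (x, hd xs) (consec xs))"

lemma consec_subset: "consec xs \<subseteq> set xs \<times> set xs"
  by (induction xs) (auto simp: neq_Nil_conv)

lemma finite_consec: "finite (consec xs)"
  using consec_subset by (rule finite_subset) simp

lemma consec_conv_nth: "consec xs = (\<lambda>i. (xs ! i, xs ! Suc i)) ` {..<length xs - 1}"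
proof (induction xs)
  case (Cons x xs)
  then show ?case
    by (cases xs) (auto simp: lessThan_Suc_eq_insert_0 image_image)
qed simp

text \<open>A path from \<open>hd xs\<close> along \<open>consec xs\<close> stays in
  \<open>set xs\<close>, so it never returns to the new head \<open>x\<close>. This is why only
  acyclic sets of arcs matter in the inclusion-exclusion.\<close>

lemma acyclic_consec:
  assumes "distinct xs"
  shows "acyclic (consec xs)"
  using assms
proof (induction xs)
  case (Cons x xs)
  have "(hd xs, x) \<notin> (consec xs)\<^sup>*" if "xs \<noteq> []"
  proof
    assume "(hd xs, x) \<in> (consec xs)\<^sup>*"
    then have "x = hd xs \<or> x \<in> set xs"
      using consec_subset[of xs] by (auto elim: rtranclE)
    then show False using Cons.prems that by auto
  qed
  then show ?case using Cons by (simp add: acyclic_insert wf_acyclic)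
qed (simp add: wf_acyclic)

text \<open>Serves as the inverse of \<open>remove1 b\<close> on distinct lists in which
  \<open>b\<close> comes directly after \<open>a\<close>.\<close>

fun insert_after :: "'a \<Rightarrow> 'a \<Rightarrow> 'a list \<Rightarrow> 'a list" where
  "insert_after a b [] = []"
| "insert_after a b (x # xs) = (if x = a then a # b # xs else x # insert_after a b xs)"

lemma insert_after_eq_Nil_iff [simp]: "insert_after a b xs = [] \<longleftrightarrow> xs = []"
  by (cases xs) auto

lemma hd_insert_after [simp]: "hd (insert_after a b xs) = hd xs"
  by (cases xs) auto

lemma set_insert_after: "a \<in> set xs \<Longrightarrow> set (insert_after a b xs) = insert b (set xs)"
  by (induction xs) auto

lemma set_insert_after_subset: "set (insert_after a b xs) \<subseteq> insert b (set xs)"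
  by (induction xs) auto

lemma distinct_insert_after:
  "distinct xs \<Longrightarrow> b \<notin> set xs \<Longrightarrow> distinct (insert_after a b xs)"
  using set_insert_after_subset[of a b] by (induction xs) fastforce+

lemma remove1_insert_after:
  "b \<notin> set xs \<Longrightarrow> a \<in> set xs \<Longrightarrow> remove1 b (insert_after a b xs) = xs"
  by (induction xs) auto

lemma consec_insert_after: "a \<in> set xs \<Longrightarrow> (a, b) \<in> consec (insert_after a b xs)"
  by (induction xs) auto

text \<open>The insertion breaks only the pair that starts at \<open>a\<close> and creates only
  pairs involving \<open>b\<close>.\<close>

lemma consec_insert_after_iff:
  "u \<noteq> a \<Longrightarrow> u \<noteq> b \<Longrightarrow> v \<noteq> b \<Longrightarrow> (u, v) \<in> consec (insert_after a b xs) \<longleftrightarrow> (u, v) \<in> consec xs"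
  by (induction xs) auto

lemma insert_after_remove1:
  "distinct xs \<Longrightarrow> (a, b) \<in> consec xs \<Longrightarrow> insert_after a b (remove1 b xs) = xs"
proof (induction xs)
  case (Cons x xs)
  then have "b \<in> set xs" using consec_subset[of xs] by (auto split: if_splits)
  then have "x \<noteq> b" using Cons.prems by auto
  have "xs \<noteq> []" using Cons.prems by auto
  show ?case
  proof (cases "x = a")
    case True
    then have "(a, b) \<notin> consec xs" using Cons.prems consec_subset[of xs] by auto
    then have "hd xs = b" using Cons.prems \<open>xs \<noteq> []\<close> by auto
    then obtain ys where "xs = b # ys" using \<open>xs \<noteq> []\<close> by (cases xs) auto
    then show ?thesis using True \<open>x \<noteq> b\<close> by simp
  next
    case False
    then show ?thesis using Cons \<open>x \<noteq> b\<close> by (auto split: if_splits)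
  qed
qed simp

section \<open>Linear orders and permutations extending a set of arcs\<close>

definition graph_of :: "('a \<Rightarrow> 'a) \<Rightarrow> 'a set \<Rightarrow> ('a \<times> 'a) set" where
  "graph_of w S = (\<lambda>x. (x, w x)) ` S"

text \<open>Deleting the end point of an arc that leads to a sink gives the same recursion for linear orders
  and for permutations; hence the two counts agree.\<close>

lemma card_lists_delete_arc:
  assumes "a \<in> V" "b \<in> V" "a \<noteq> b"
    and "a \<notin> Domain P" "b \<notin> Domain P" "b \<notin> Range P"
  shows "card {xs \<in> permutations_of_set V. insert (a, b) P \<subseteq> consec xs}
    = card {xs \<in> permutations_of_set (V - {b}). P \<subseteq> consec xs}"
proof (rule bij_betw_same_card[of "remove1 b"], rule bij_betw_byWitness[where f' = "insert_after a b"])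
  show "\<forall>xs\<in>{xs \<in> permutations_of_set V. insert (a, b) P \<subseteq> consec xs}.
      insert_after a b (remove1 b xs) = xs"
    by (auto simp: permutations_of_set_def insert_after_remove1)
  show "\<forall>xs\<in>{xs \<in> permutations_of_set (V - {b}). P \<subseteq> consec xs}.
      remove1 b (insert_after a b xs) = xs"
    using assms by (auto simp: permutations_of_set_def remove1_insert_after)
  \<comment> \<open>These are the side conditions under which inserting or removing \<open>b\<close>
    preserves the pairs of \<open>P\<close>.\<close>
  have arc: "u \<noteq> a \<and> u \<noteq> b \<and> v \<noteq> b" if "(u, v) \<in> P" for u v
    using that assms by auto
  show "remove1 b ` {xs \<in> permutations_of_set V. insert (a, b) P \<subseteq> consec xs}
    \<subseteq> {xs \<in> permutations_of_set (V - {b}). P \<subseteq> consec xs}"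
  proof clarify
    fix xs assume xs: "xs \<in> permutations_of_set V" "insert (a, b) P \<subseteq> consec xs"
    then have "distinct xs" "insert_after a b (remove1 b xs) = xs"
      by (auto simp: permutations_of_set_def insert_after_remove1)
    then have "P \<subseteq> consec (remove1 b xs)"
      using arc xs(2) consec_insert_after_iff[of _ a b _ "remove1 b xs"] by auto
    then show "remove1 b xs \<in> permutations_of_set (V - {b}) \<and> P \<subseteq> consec (remove1 b xs)"
      using xs by (auto simp: permutations_of_set_def)
  qed
  show "insert_after a b ` {xs \<in> permutations_of_set (V - {b}). P \<subseteq> consec xs}
    \<subseteq> {xs \<in> permutations_of_set V. insert (a, b) P \<subseteq> consec xs}"
  proof clarify
    fix xs assume xs: "xs \<in> permutations_of_set (V - {b})" "P \<subseteq> consec xs"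
    then have *: "a \<in> set xs" "b \<notin> set xs" "distinct xs" "set xs = V - {b}"
      using assms by (auto simp: permutations_of_set_def)
    then have "insert_after a b xs \<in> permutations_of_set V"
      using assms by (auto simp: permutations_of_set_def set_insert_after distinct_insert_after)
    moreover have "insert (a, b) P \<subseteq> consec (insert_after a b xs)"
      using arc xs(2) * by (auto simp: consec_insert_after consec_insert_after_iff)
    ultimately show "insert_after a b xs \<in> permutations_of_set V
        \<and> insert (a, b) P \<subseteq> consec (insert_after a b xs)" ..
  qed
qed

text \<open>Precomposing with the transposition bypasses \<open>b\<close>: if
  \<open>w a = b\<close>, the new map fixes \<open>b\<close> and sends \<open>a\<close> to
  \<open>w b\<close>. The same operation goes back, and it leaves the values at the tails of arcs in
  \<open>P\<close> alone.\<close>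

lemma card_permutes_delete_arc:
  assumes "a \<in> V" "b \<in> V"
    and "a \<notin> Domain P" "b \<notin> Domain P"
  shows "card {w. w permutes V \<and> (\<forall>(x, y)\<in>insert (a, b) P. w x = y)}
    = card {w. w permutes V - {b} \<and> (\<forall>(x, y)\<in>P. w x = y)}"
proof (rule bij_betw_same_card[of "\<lambda>w. w \<circ> transpose a b"],
    rule bij_betw_byWitness[where f' = "\<lambda>w. w \<circ> transpose a b"])
  have arc: "transpose a b u = u" if "(u, v) \<in> P" for u v
    using that assms by (auto simp: transpose_def)
  have tr: "transpose a b permutes V" using assms by (simp add: permutes_swap_id)
  show "(\<lambda>w. w \<circ> transpose a b) ` {w. w permutes V \<and> (\<forall>(x, y)\<in>insert (a, b) P. w x = y)}
      \<subseteq> {w. w permutes V - {b} \<and> (\<forall>(x, y)\<in>P. w x = y)}"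
  proof clarify
    fix w assume w: "w permutes V" "\<forall>(x, y)\<in>insert (a, b) P. w x = y"
    have "w \<circ> transpose a b permutes V" using tr w(1) by (rule permutes_compose)
    then have "w \<circ> transpose a b permutes V - {b}"
      by (rule permutes_superset) (use w in auto)
    then show "w \<circ> transpose a b permutes V - {b} \<and> (\<forall>(x, y)\<in>P. (w \<circ> transpose a b) x = y)"
      using w arc by fastforce
  qed
  show "(\<lambda>w. w \<circ> transpose a b) ` {w. w permutes V - {b} \<and> (\<forall>(x, y)\<in>P. w x = y)}
      \<subseteq> {w. w permutes V \<and> (\<forall>(x, y)\<in>insert (a, b) P. w x = y)}"
  proof clarify
    fix w assume w: "w permutes V - {b}" "\<forall>(x, y)\<in>P. w x = y"
    have "w permutes V" using w(1) by (rule permutes_subset) auto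
    then have "w \<circ> transpose a b permutes V" using tr permutes_compose by blast
    moreover have "w b = b" using w(1) by (simp add: permutes_not_in)
    ultimately show "w \<circ> transpose a b permutes V
        \<and> (\<forall>(x, y)\<in>insert (a, b) P. (w \<circ> transpose a b) x = y)"
      using w arc by fastforce
  qed
qed (auto simp: o_assoc[symmetric])

text \<open>The converse of a finite acyclic relation is well-founded. An element \<open>b\<close>
  of the range that is minimal for it has no outgoing arc, since the target would again be in the
  range.\<close>

lemma finite_acyclic_ex_sink_arc:
  assumes "finite P" "acyclic P" "P \<noteq> {}"
  obtains a b where "(a, b) \<in> P" "b \<notin> Domain P"
proof -
  have "wf (P\<inverse>)" using assms by (intro finite_acyclic_wf_converse)
  then obtain b where "b \<in> Range P" "\<And>y. (y, b) \<in> P\<inverse> \<Longrightarrow> y \<notin> Range P"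
    using wfE_min[of "P\<inverse>" _ "Range P"] assms(3) by (metis Range_empty_iff all_not_in_conv)
  then show ?thesis using that by blast
qed

lemma card_lists_eq_card_permutes:
  assumes "finite V" "P \<subseteq> V \<times> V" "acyclic P"
  shows "card {xs \<in> permutations_of_set V. P \<subseteq> consec xs}
    = card {w. w permutes V \<and> (\<forall>(x, y)\<in>P. w x = y)}"
proof -
  have "finite P" using assms finite_subset by blast
  then show ?thesis using assms
  proof (induction "card P" arbitrary: P V)
    case 0
    then have "{xs \<in> permutations_of_set V. P \<subseteq> consec xs} = permutations_of_set V"
      "{w. w permutes V \<and> (\<forall>(x, y)\<in>P. w x = y)} = {w. w permutes V}"
      by auto
    then show ?case using 0 by (simp add: card_permutations)
  next
    case (Suc m)
    then have "P \<noteq> {}" by auto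
    then obtain a b where ab: "(a, b) \<in> P" "b \<notin> Domain P"
      using finite_acyclic_ex_sink_arc Suc.prems by metis
    define Q where "Q = P - {(a, b)}"
    have PQ: "P = insert (a, b) Q" using ab unfolding Q_def by auto
    have V: "a \<in> V" "b \<in> V" "a \<noteq> b" using ab Suc.prems by auto
    show ?case
    \<comment> \<open>If another arc leaves \<open>a\<close> or enters \<open>b\<close>, both counts
      are zero: an entry of a distinct list has at most one neighbour on each side, and a
      permutation is an injective function. Otherwise \<open>b\<close> can be deleted.\<close>
    proof (cases "a \<in> Domain Q \<or> b \<in> Range Q")
      case False
      have "card {xs \<in> permutations_of_set V. P \<subseteq> consec xs}
          = card {xs \<in> permutations_of_set (V - {b}). Q \<subseteq> consec xs}"
        unfolding PQ using V False ab by (intro card_lists_delete_arc) (auto simp: Q_def)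
      also have "\<dots> = card {w. w permutes V - {b} \<and> (\<forall>(x, y)\<in>Q. w x = y)}"
      proof (rule Suc.hyps)
        show "m = card Q" using Suc.hyps(2) ab Suc.prems unfolding Q_def by simp
        show "Q \<subseteq> (V - {b}) \<times> (V - {b})" using Suc.prems ab False unfolding Q_def by auto
        show "acyclic Q" using Suc.prems unfolding Q_def by (meson Diff_subset acyclic_subset)
      qed (use Suc.prems Q_def in auto)
      also have "\<dots> = card {w. w permutes V \<and> (\<forall>(x, y)\<in>P. w x = y)}"
        unfolding PQ using V False ab by (intro card_permutes_delete_arc[symmetric]) (auto simp: Q_def)
      finally show ?thesis .
    next
      case True
      then obtain c d where cd: "(c, d) \<in> P" "(c = a \<and> d \<noteq> b) \<or> (c \<noteq> a \<and> d = b)"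
        unfolding Q_def by auto
      have "\<not> P \<subseteq> consec xs" if "xs \<in> permutations_of_set V" for xs
      proof
        assume "P \<subseteq> consec xs"
        then have "(a, b) \<in> consec xs" "(c, d) \<in> consec xs" using ab cd by auto
        then show False using cd(2) that
          by (auto simp: consec_conv_nth permutations_of_set_def nth_eq_iff_index_eq)
      qed
      moreover have "\<not> (\<forall>(x, y)\<in>P. w x = y)" if "w permutes V" for w
      proof
        assume "\<forall>(x, y)\<in>P. w x = y"
        then have "w a = b" "w c = d" using ab cd by auto
        then show False using cd(2) permutes_inj[OF that] by (auto dest: injD)
      qed
      ultimately have e: "{xs \<in> permutations_of_set V. P \<subseteq> consec xs} = {}"
        "{w. w permutes V \<and> (\<forall>(x, y)\<in>P. w x = y)} = {}" by blast+
      show ?thesis by (simp only: e card.empty)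
    qed
  qed
qed

section \<open>Inclusion-exclusion\<close>

lemma sum_Pow_alternating:
  assumes "finite A"
  shows "(\<Sum>S\<in>Pow A. (-1) ^ card S) = (if A = {} then 1 else 0 :: int)"
  using assms
proof (induction A)
  case (insert a A)
  have "inj_on (insert a) (Pow A)" using insert.hyps by (auto simp: inj_on_def)
  moreover have "Pow A \<inter> insert a ` Pow A = {}" using insert.hyps by auto
  moreover have "(-1) ^ card (insert a S) = - ((-1) ^ card S :: int)" if "S \<in> Pow A" for S
  proof -
    have "finite S" "a \<notin> S" using that insert.hyps finite_subset by auto
    then show ?thesis by simp
  qed
  ultimately show ?case using insert.hyps
    by (simp add: Pow_insert sum.union_disjoint sum.reindex sum_negf)
qed simp

lemma graph_of_subset_iff: "graph_of w S \<subseteq> B \<longleftrightarrow> S \<subseteq> {x. (x, w x) \<in> B}"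
  by (auto simp: graph_of_def)

text \<open>The indicator of avoiding \<open>B\<close> becomes an alternating sum over sets
  \<open>P\<close> of consecutive pairs. For each \<open>P\<close> the lists are then traded for
  permutations, and the sum is regrouped by permutations.\<close>

lemma card_lists_avoiding:
  fixes V :: "'a set"
  assumes V: "finite V" and B: "B \<subseteq> V \<times> V"
  shows "int (card {xs \<in> permutations_of_set V. consec xs \<inter> B = {}})
    = (\<Sum>w | w permutes V. \<Sum>S | S \<subseteq> {x. (x, w x) \<in> B} \<and> acyclic (graph_of w S). (-1) ^ card S)"
proof -
  let ?L = "permutations_of_set V" and ?W = "{w. w permutes V}"
  let ?A = "{P. P \<subseteq> B \<and> acyclic P}"
  let ?s = "\<lambda>P. (-1) ^ card P :: int"
  have finB: "finite B" using assms finite_subset by blast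
  then have finA: "finite ?A" by simp
  have finW: "finite ?W" using V by (rule finite_permutations)
  have "int (card {xs \<in> ?L. consec xs \<inter> B = {}}) = (\<Sum>xs\<in>?L. if consec xs \<inter> B = {} then 1 else 0)"
    by (simp add: sum.If_cases Int_def)
  also have "\<dots> = (\<Sum>xs\<in>?L. \<Sum>P\<in>Pow (consec xs \<inter> B). ?s P)"
    by (simp add: sum_Pow_alternating finite_consec del: Pow_Int_eq)
  \<comment> \<open>Acyclicity comes for free, since the pairs of a distinct list contain no
    cycle.\<close>
  also have "\<dots> = (\<Sum>xs\<in>?L. \<Sum>P | P \<in> ?A \<and> P \<subseteq> consec xs. ?s P)"
  proof (intro sum.cong refl)
    fix xs assume "xs \<in> ?L"
    then have "acyclic (consec xs)" by (simp add: permutations_of_set_def acyclic_consec)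
    then show "Pow (consec xs \<inter> B) = {P. P \<in> ?A \<and> P \<subseteq> consec xs}"
      using acyclic_subset by auto
  qed
  also have "\<dots> = (\<Sum>P\<in>?A. \<Sum>xs | xs \<in> ?L \<and> P \<subseteq> consec xs. ?s P)"
    using finA by (intro sum.swap_restrict) auto
  also have "\<dots> = (\<Sum>P\<in>?A. \<Sum>w | w \<in> ?W \<and> (\<forall>(x, y)\<in>P. w x = y). ?s P)"
  proof (intro sum.cong refl)
    fix P assume "P \<in> ?A"
    then have "card {xs \<in> ?L. P \<subseteq> consec xs} = card {w. w \<in> ?W \<and> (\<forall>(x, y)\<in>P. w x = y)}"
      using card_lists_eq_card_permutes[of V P] assms by auto
    then show "(\<Sum>xs | xs \<in> ?L \<and> P \<subseteq> consec xs. ?s P)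
        = (\<Sum>w | w \<in> ?W \<and> (\<forall>(x, y)\<in>P. w x = y). ?s P)"
      by (simp only: sum_constant)
  qed
  also have "\<dots> = (\<Sum>w\<in>?W. \<Sum>P | P \<in> ?A \<and> (\<forall>(x, y)\<in>P. w x = y). ?s P)"
    using finA finW by (intro sum.swap_restrict)
  \<comment> \<open>A set \<open>P\<close> of arcs \<open>(x, w x)\<close> is determined by its set
    of tails \<open>Domain P\<close>, which has the same cardinality.\<close>
  also have "\<dots> = (\<Sum>w\<in>?W. \<Sum>S | S \<subseteq> {x. (x, w x) \<in> B} \<and> acyclic (graph_of w S). ?s S)"
  proof (intro sum.cong refl)
    fix w :: "'a \<Rightarrow> 'a"
    have inj: "inj_on (\<lambda>x. (x, w x)) S" for S by (auto simp: inj_on_def)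
    have dom: "graph_of w (Domain P) = P" if "\<forall>(x, y)\<in>P. w x = y" for P
      using that unfolding graph_of_def by force
    show "(\<Sum>P | P \<in> ?A \<and> (\<forall>(x, y)\<in>P. w x = y). ?s P)
        = (\<Sum>S | S \<subseteq> {x. (x, w x) \<in> B} \<and> acyclic (graph_of w S). ?s S)"
    proof (rule sum.reindex_bij_witness[where i = "graph_of w" and j = Domain])
      fix P assume P: "P \<in> {P. P \<in> ?A \<and> (\<forall>(x, y)\<in>P. w x = y)}"
      then show "graph_of w (Domain P) = P" using dom by blast
      then show "Domain P \<in> {S. S \<subseteq> {x. (x, w x) \<in> B} \<and> acyclic (graph_of w S)}"
        using P graph_of_subset_iff[of w "Domain P" B] by simp
      show "?s (Domain P) = ?s P"
        using \<open>graph_of w (Domain P) = P\<close> card_image[OF inj, of "Domain P"]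
        by (simp add: graph_of_def)
    next
      fix S assume "S \<in> {S. S \<subseteq> {x. (x, w x) \<in> B} \<and> acyclic (graph_of w S)}"
      then show "graph_of w S \<in> {P. P \<in> ?A \<and> (\<forall>(x, y)\<in>P. w x = y)}"
        using graph_of_subset_iff[of w S B] by (auto simp: graph_of_def)
      show "Domain (graph_of w S) = S" by (force simp: graph_of_def)
    qed
  qed
  finally show ?thesis .
qed

text \<open>The arcs \<open>(x, w x)\<close> form disjoint cycles, one for each orbit, so some of
  them close a cycle only by containing all arcs of an orbit.\<close>

lemma acyclic_graph_of_iff:
  assumes "permutation w"
  shows "acyclic (graph_of w S) \<longleftrightarrow> (\<forall>x. \<not> orbit w x \<subseteq> S)"
proof (intro iffI allI notI)
  fix x assume acyc: "acyclic (graph_of w S)" and sub: "orbit w x \<subseteq> S"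
  have x: "x \<in> orbit w x" using assms by (rule permutation_self_in_orbit)
  have "(x, y) \<in> (graph_of w S)\<^sup>+" if "y \<in> orbit w x" for y
    using that
  proof induction
    case base
    then show ?case using x sub by (auto simp: graph_of_def)
  next
    case (step y)
    then have "(y, w y) \<in> graph_of w S" using sub by (auto simp: graph_of_def)
    then show ?case using step.IH by simp
  qed
  then show False using x acyc unfolding acyclic_def by blast
next
  assume no: "\<forall>x. \<not> orbit w x \<subseteq> S"
  show "acyclic (graph_of w S)"
  proof (rule ccontr)
    assume "\<not> acyclic (graph_of w S)"
    then obtain x where x: "(x, x) \<in> (graph_of w S)\<^sup>+" by (auto simp: acyclic_def)
    \<comment> \<open>The only arc that can leave \<open>y\<close> is \<open>(y, w y)\<close>. If it
      already ends at \<open>x\<close>, the closed path at \<open>x\<close> continues it.\<close>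
    have step: "y \<in> S \<and> (w y, x) \<in> (graph_of w S)\<^sup>+" if "(y, x) \<in> (graph_of w S)\<^sup>+" for y
      using that x by (cases rule: converse_tranclE) (auto simp: graph_of_def)
    have "(y, x) \<in> (graph_of w S)\<^sup>+" if "y \<in> orbit w x" for y
      using that by induction (use step x in auto)
    then have "orbit w x \<subseteq> S" using step by blast
    then show False using no by blast
  qed
qed

text \<open>The factor contributed by the cycle \<open>C\<close> of \<open>w\<close> when \<open>T\<close> is the set of all \<open>x\<close> for which
  \<open>(x, w x)\<close> is an arc.\<close>

definition cycle_sign :: "'a set \<Rightarrow> 'a set \<Rightarrow> int" where
  "cycle_sign T C = (if T \<inter> C = {} then 1 else if C \<subseteq> T then (-1) ^ (card C - 1) else 0)"

lemma cycle_sign_cong: "T \<inter> C = T' \<inter> C \<Longrightarrow> cycle_sign T C = cycle_sign T' C"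
proof -
  assume "T \<inter> C = T' \<inter> C"
  moreover from this have "C \<subseteq> T \<longleftrightarrow> C \<subseteq> T'" by blast
  ultimately show ?thesis unfolding cycle_sign_def by simp
qed

text \<open>Over all subsets of \<open>T \<inter> C\<close> the signs cancel unless this set is
  empty. If \<open>C \<subseteq> T\<close>, forbidding \<open>S = C\<close> removes the term
  \<open>(-1) ^ card C\<close> from a zero sum.\<close>

lemma sum_proper_subsets_alternating:
  assumes "finite C" "C \<noteq> {}"
  shows "(\<Sum>S | S \<subseteq> T \<inter> C \<and> \<not> C \<subseteq> S. (-1) ^ card S) = cycle_sign T C"
proof (cases "C \<subseteq> T")
  case True
  then have "{S. S \<subseteq> T \<inter> C \<and> \<not> C \<subseteq> S} = Pow C - {C}" "T \<inter> C = C" by auto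
  moreover have "(-1) ^ card C = - ((-1) ^ (card C - 1) :: int)"
    using assms by (cases "card C") auto
  ultimately show ?thesis
    using assms True sum_Pow_alternating[of C] by (simp add: sum_diff1 cycle_sign_def)
next
  case False
  then have "{S. S \<subseteq> T \<inter> C \<and> \<not> C \<subseteq> S} = Pow (T \<inter> C)" by auto
  then show ?thesis using assms False sum_Pow_alternating[of "T \<inter> C"] by (simp add: cycle_sign_def)
qed

text \<open>The condition on \<open>S\<close> concerns each block separately, and the sign is
  multiplicative over disjoint parts. \<open>T\<close> varies because the induction hypothesis is
  applied to \<open>T - C\<close>.\<close>

lemma sum_containing_no_block:
  assumes "finite \<C>" "disjoint \<C>" "\<And>C. C \<in> \<C> \<Longrightarrow> finite C \<and> C \<noteq> {}" "T \<subseteq> \<Union>\<C>"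
  shows "(\<Sum>S | S \<subseteq> T \<and> (\<forall>C\<in>\<C>. \<not> C \<subseteq> S). (-1) ^ card S) = (\<Prod>C\<in>\<C>. cycle_sign T C)"
  using assms
proof (induction \<C> arbitrary: T)
  case (insert C \<C>)
  let ?s = "\<lambda>S. (-1) ^ card S :: int"
  let ?A = "{S. S \<subseteq> T \<inter> C \<and> \<not> C \<subseteq> S}" and ?B = "{S. S \<subseteq> T - C \<and> (\<forall>D\<in>\<C>. \<not> D \<subseteq> S)}"
  have disj: "C \<inter> D = {}" if "D \<in> \<C>" for D
    using that insert.prems(1) insert.hyps(2) by (auto simp: disjoint_def)
  have "finite (\<Union>(insert C \<C>))" using insert by blast
  then have finT: "finite T" using insert.prems(3) by (rule rev_finite_subset)
  have "(\<Sum>S | S \<subseteq> T \<and> (\<forall>D\<in>insert C \<C>. \<not> D \<subseteq> S). ?s S) = (\<Sum>(R, S)\<in>?A \<times> ?B. ?s R * ?s S)"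
  proof (rule sum.reindex_bij_witness[where i = "\<lambda>(R, S). R \<union> S" and j = "\<lambda>S. (S \<inter> C, S - C)"])
    fix S assume S: "S \<in> {S. S \<subseteq> T \<and> (\<forall>D\<in>insert C \<C>. \<not> D \<subseteq> S)}"
    show "(case (S \<inter> C, S - C) of (R, S) \<Rightarrow> R \<union> S) = S" by auto
    show "(S \<inter> C, S - C) \<in> ?A \<times> ?B" using S by auto
    have "finite S" using S finT finite_subset by auto
    then have "card S = card (S \<inter> C) + card (S - C)"
      by (metis Int_Diff_Un Int_Diff_disjoint card_Un_disjoint finite_Diff finite_Int)
    then show "(case (S \<inter> C, S - C) of (R, S) \<Rightarrow> ?s R * ?s S) = ?s S"
      by (simp add: power_add)
  next
    fix p assume "p \<in> ?A \<times> ?B"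
    then obtain R S where p: "p = (R, S)" "R \<in> ?A" "S \<in> ?B" by auto
    show "((case p of (R, S) \<Rightarrow> R \<union> S) \<inter> C, (case p of (R, S) \<Rightarrow> R \<union> S) - C) = p"
      using p by auto
    have "\<not> D \<subseteq> R \<union> S" if "D \<in> \<C>" for D using disj[OF that] p that by blast
    moreover have "\<not> C \<subseteq> R \<union> S" using p by blast
    ultimately show "(case p of (R, S) \<Rightarrow> R \<union> S) \<in> {S. S \<subseteq> T \<and> (\<forall>D\<in>insert C \<C>. \<not> D \<subseteq> S)}"
      using p by auto
  qed
  also have "\<dots> = (\<Sum>R\<in>?A. ?s R) * (\<Sum>S\<in>?B. ?s S)"
    by (simp add: sum_product sum.cartesian_product)
  also have "(\<Sum>R\<in>?A. ?s R) = cycle_sign T C"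
    using insert.prems(2) by (intro sum_proper_subsets_alternating) auto
  also have "(\<Sum>S\<in>?B. ?s S) = (\<Prod>D\<in>\<C>. cycle_sign (T - C) D)"
    using insert.prems by (intro insert.IH) (auto simp: disjoint_def)
  \<comment> \<open>Removing \<open>C\<close> from \<open>T\<close> does not change the part of
    \<open>T\<close> inside another block.\<close>
  also have "\<dots> = (\<Prod>D\<in>\<C>. cycle_sign T D)"
    using disj by (intro prod.cong refl cycle_sign_cong) blast
  finally show ?case using insert.hyps by simp
qed simp

section \<open>Orbits of a permutation of a finite set\<close>

definition orbits :: "('a \<Rightarrow> 'a) \<Rightarrow> 'a set \<Rightarrow> 'a set set" where
  "orbits w V = orbit w ` V"

lemma orbits_eq_orbit:
  assumes "w permutes V" "finite V" "C \<in> orbits w V" "x \<in> C"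
  shows "C = orbit w x"
proof -
  obtain y where "C = orbit w y" using assms(3) by (auto simp: orbits_def)
  then have "cyclic_on w C" using cyclic_on_orbit assms by metis
  then show ?thesis using orbit_cyclic_eq3 assms(4) by metis
qed

lemma disjoint_orbits:
  assumes "w permutes V" "finite V"
  shows "disjoint (orbits w V)"
proof (rule disjointI)
  fix C D assume "C \<in> orbits w V" "D \<in> orbits w V" "C \<noteq> D"
  then show "C \<inter> D = {}" using orbits_eq_orbit[OF assms] by blast
qed

lemma orbits_subset: "w permutes V \<Longrightarrow> C \<in> orbits w V \<Longrightarrow> C \<subseteq> V"
  by (auto simp: orbits_def dest: permutes_orbit_subset)

lemma orbits_nonempty: "C \<in> orbits w V \<Longrightarrow> C \<noteq> {}"
  by (auto simp: orbits_def orbit_nonempty)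

text \<open>\<open>orbit w x\<close> is generated from \<open>w x\<close>; finiteness guarantees the
  return to \<open>x\<close>.\<close>

lemma self_in_orbit_permutes: "w permutes V \<Longrightarrow> finite V \<Longrightarrow> x \<in> orbit w x"
  by (meson permutation_permutes permutation_self_in_orbit)

lemma Union_orbits:
  assumes "w permutes V" "finite V"
  shows "\<Union>(orbits w V) = V"
proof
  show "\<Union>(orbits w V) \<subseteq> V" using orbits_subset[OF assms(1)] by (rule Union_least)
  show "V \<subseteq> \<Union>(orbits w V)" using self_in_orbit_permutes[OF assms] by (auto simp: orbits_def)
qed

text \<open>For fixed \<open>w\<close> the acyclic sets are those containing no full orbit. The
  orbits partition \<open>V\<close>, so the inner sum factors over the cycles.\<close>

lemma card_lists_avoiding_eq_sum_cycle_sign: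
  assumes V: "finite V" and B: "B \<subseteq> V \<times> V"
  shows "int (card {xs \<in> permutations_of_set V. consec xs \<inter> B = {}})
    = (\<Sum>w | w permutes V. \<Prod>C\<in>orbits w V. cycle_sign {x. (x, w x) \<in> B} C)"
  unfolding card_lists_avoiding[OF assms]
proof (intro sum.cong refl)
  fix w assume "w \<in> {w. w permutes V}"
  then have w: "w permutes V" by simp
  then have pw: "permutation w" using V permutation_permutes by blast
  let ?T = "{x. (x, w x) \<in> B}"
  have T: "?T \<subseteq> V" using B by auto
  \<comment> \<open>A point outside \<open>V\<close> lies in its own orbit but not in
    \<open>S\<close>, so only orbits of points of \<open>V\<close> matter.\<close>
  have "acyclic (graph_of w S) \<longleftrightarrow> (\<forall>C\<in>orbits w V. \<not> C \<subseteq> S)" if "S \<subseteq> ?T" for S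
    unfolding acyclic_graph_of_iff[OF pw] orbits_def
    using that T permutation_self_in_orbit[OF pw] by blast
  then have "{S. S \<subseteq> ?T \<and> acyclic (graph_of w S)} = {S. S \<subseteq> ?T \<and> (\<forall>C\<in>orbits w V. \<not> C \<subseteq> S)}"
    by blast
  moreover have "finite C \<and> C \<noteq> {}" if "C \<in> orbits w V" for C
    using that orbits_subset[OF w] V finite_subset orbits_nonempty by metis
  ultimately show "(\<Sum>S | S \<subseteq> ?T \<and> acyclic (graph_of w S). (-1) ^ card S)
      = (\<Prod>C\<in>orbits w V. cycle_sign ?T C)"
    using sum_containing_no_block[OF _ disjoint_orbits[OF w V], of ?T] V T Union_orbits[OF w V]
    by (simp add: orbits_def)
qed

section \<open>Reversing cycles of a permutation\<close>

text \<open>Intended for a union \<open>A\<close> of cycles of \<open>w\<close>, which are then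
  traversed backwards.\<close>

definition reverse_on :: "'a set \<Rightarrow> ('a \<Rightarrow> 'a) \<Rightarrow> 'a \<Rightarrow> 'a" where
  "reverse_on A w x = (if x \<in> A then inv' w x else w x)"

text \<open>The equivalence makes both \<open>A\<close> and its complement closed under
  \<open>w\<close>, so inverting \<open>w\<close> on one of them alone still gives a
  bijection.\<close>

locale invariant_subset =
  fixes w :: "'a \<Rightarrow> 'a" and V A :: "'a set"
  assumes w: "w permutes V" and V: "finite V" and A: "\<And>x. w x \<in> A \<longleftrightarrow> x \<in> A"
begin

lemma inv_in_iff: "inv' w x \<in> A \<longleftrightarrow> x \<in> A"
  using A[of "inv' w x"] w by (simp add: permutes_inverses)

lemma reverse_on_inverses:
  "reverse_on A (inv' w) (reverse_on A w x) = x" "reverse_on A w (reverse_on A (inv' w) x) = x"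
  using w by (auto simp: reverse_on_def A inv_in_iff permutes_inverses permutes_inv_inv)

lemma reverse_on_permutes: "reverse_on A w permutes V"
proof -
  have "w x \<in> V" "inv' w x \<in> V" if "x \<in> V" for x
    using that w by (simp_all add: permutes_in_image permutes_inv)
  then have "bij_betw (reverse_on A w) V V"
    using w by (intro bij_betw_byWitness[where f' = "reverse_on A (inv' w)"])
      (auto simp: reverse_on_inverses, auto simp: reverse_on_def permutes_inv_inv)
  moreover have "reverse_on A w x = x" if "x \<notin> V" for x
    using that w permutes_inv[OF w] by (simp add: reverse_on_def permutes_not_in)
  ultimately show ?thesis by (rule bij_imp_permutes)
qed

lemma inv_reverse_on: "inv' (reverse_on A w) = reverse_on A (inv' w)"
  using reverse_on_inverses by (intro inv_equality)

lemma reverse_on_reverse_on: "reverse_on A (reverse_on A w) = w"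
  unfolding fun_eq_iff reverse_on_def[of A "reverse_on A w"] inv_reverse_on
  using w by (simp add: reverse_on_def permutes_inv_inv)

text \<open>Inside \<open>A\<close> the new map is the inverse of \<open>w\<close>, which has the
  same orbits; outside it is \<open>w\<close>. No orbit leaves the part in which it starts.\<close>

lemma orbit_reverse_on: "orbit (reverse_on A w) x = orbit w x"
proof -
  have pw: "permutation w" using w V permutation_permutes by blast
  show ?thesis
  proof (cases "x \<in> A")
    case True
    have "orbit (inv' w) x = orbit (reverse_on A w) x"
      by (rule orbit_cong0[of x A]) (auto simp: True inv_in_iff reverse_on_def)
    then show ?thesis using orbit_inv_eq[OF pw] by simp
  next
    case False
    have "orbit w x = orbit (reverse_on A w) x"
      by (rule orbit_cong0[of x "- A"]) (auto simp: False A reverse_on_def)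
    then show ?thesis by simp
  qed
qed

lemma orbits_reverse_on: "orbits (reverse_on A w) V = orbits w V"
  by (simp add: orbits_def orbit_reverse_on)

end

lemma invariant_subset_Union_orbits:
  assumes "w permutes V" "finite V" "\<A> \<subseteq> orbits w V"
  shows "invariant_subset w V (\<Union>\<A>)"
proof
  fix x
  have pw: "permutation w" using assms permutation_permutes by blast
  have "w x \<in> C \<longleftrightarrow> x \<in> C" if "C \<in> \<A>" for C
    using orbits_eq_orbit[OF assms(1,2)] that assms(3) self_in_orbit_permutes[OF assms(1,2)]
      permutation_orbit_step[OF pw, of x] by blast
  then show "w x \<in> \<Union>\<A> \<longleftrightarrow> x \<in> \<Union>\<A>" by auto
qed (use assms in auto)

lemma invariant_subset_orbit:
  assumes "w permutes V" "finite V" "C \<in> orbits w V"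
  shows "invariant_subset w V C"
  using invariant_subset_Union_orbits[of w V "{C}"] assms by simp

lemma orbits_eq_singleton:
  assumes "w permutes V" "finite V" "C \<in> orbits w V" "x \<in> C" "w x = x"
  shows "C = {x}"
  using orbits_eq_orbit[OF assms(1-4)] orbit_eq_singleton_iff assms(5) by metis

text \<open>Here \<open>B\<close> plays the role of the arcs of the reversed tournament.\<close>

locale tournament_arcs =
  fixes V :: "'a set" and B :: "('a \<times> 'a) set"
  assumes V: "finite V" and B: "B \<subseteq> V \<times> V"
    and irrefl: "(x, x) \<notin> B"
    and total: "x \<in> V \<Longrightarrow> y \<in> V \<Longrightarrow> x \<noteq> y \<Longrightarrow> (x, y) \<in> B \<longleftrightarrow> (y, x) \<notin> B"
begin

section \<open>Effect of reversing a cycle on its arcs in \<open>B\<close>\<close>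

definition tails :: "('a \<Rightarrow> 'a) \<Rightarrow> 'a set" where
  "tails w = {x. (x, w x) \<in> B}"

text \<open>The new arc at \<open>x\<close> is \<open>(x, inv' w x)\<close>, the reverse of the arc
  of \<open>w\<close> entering \<open>x\<close>; exactly one of the two is in
  \<open>B\<close>.\<close>

lemma in_tails_reverse_on:
  assumes "w permutes V" "x \<in> V" "x \<in> A" "w x \<noteq> x"
  shows "x \<in> tails (reverse_on A w) \<longleftrightarrow> inv' w x \<notin> tails w"
proof -
  have "inv' w x \<noteq> x" "inv' w x \<in> V" "w (inv' w x) = x"
    using assms by (auto simp: permutes_inverses permutes_in_image permutes_inv permutes_inv_eq)
  then show ?thesis using total[of x "inv' w x"] assms by (simp add: tails_def reverse_on_def)
qed

lemma in_tails_reverse_on_outside: "x \<notin> A \<Longrightarrow> x \<in> tails (reverse_on A w) \<longleftrightarrow> x \<in> tails w"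
  by (simp add: tails_def reverse_on_def)

text \<open>Reversal flips the status of every arc, up to the shift by \<open>inv' w\<close>. The
  shift maps \<open>C\<close> onto itself, so statements about all points of \<open>C\<close> do not
  see it.\<close>

lemma reversed_orbit_tails:
  assumes w: "w permutes V" and C: "C \<in> orbits w V" "card C \<noteq> 1" and sub: "C \<subseteq> A"
  shows "tails (reverse_on A w) \<inter> C = {} \<longleftrightarrow> C \<subseteq> tails w"
    and "C \<subseteq> tails (reverse_on A w) \<longleftrightarrow> tails w \<inter> C = {}"
proof -
  interpret invariant_subset w V C by (rule invariant_subset_orbit[OF w V C(1)])
  have eq: "x \<in> tails (reverse_on A w) \<longleftrightarrow> inv' w x \<notin> tails w" if "x \<in> C" for x
  proof (rule in_tails_reverse_on[OF w])
    show "w x \<noteq> x" using orbits_eq_singleton[OF w V C(1) that] C(2) by auto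
  qed (use that sub orbits_subset[OF w C(1)] in auto)
  have img: "inv' w ` C = C"
  proof
    show "C \<subseteq> inv' w ` C"
    proof
      fix x assume "x \<in> C"
      then have "w x \<in> C" "x = inv' w (w x)" using A w by (auto simp: permutes_inverses)
      then show "x \<in> inv' w ` C" by blast
    qed
  qed (use inv_in_iff in auto)
  have shift: "(\<forall>x\<in>C. Q (inv' w x)) \<longleftrightarrow> (\<forall>x\<in>C. Q x)" for Q
    using ball_simps(9)[of "inv' w" C Q] by (simp only: img)
  have "tails (reverse_on A w) \<inter> C = {} \<longleftrightarrow> (\<forall>x\<in>C. inv' w x \<in> tails w)"
    using eq by blast
  then show "tails (reverse_on A w) \<inter> C = {} \<longleftrightarrow> C \<subseteq> tails w"
    unfolding shift[of "\<lambda>x. x \<in> tails w"] by blast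
  have "C \<subseteq> tails (reverse_on A w) \<longleftrightarrow> (\<forall>x\<in>C. inv' w x \<notin> tails w)"
    using eq by blast
  then show "C \<subseteq> tails (reverse_on A w) \<longleftrightarrow> tails w \<inter> C = {}"
    unfolding shift[of "\<lambda>x. x \<notin> tails w"] by blast
qed

lemma unreversed_orbit_tails:
  assumes "C \<inter> A = {}"
  shows "tails (reverse_on A w) \<inter> C = tails w \<inter> C"
  using assms in_tails_reverse_on_outside[of _ A w] by blast

text \<open>A fixed point gives only the loop \<open>(x, x)\<close>, which is never in
  \<open>B\<close>.\<close>

lemma trivial_orbit_tails:
  assumes "w permutes V" "C \<in> orbits w V" "card C = 1"
  shows "tails w \<inter> C = {}"
proof -
  obtain x where "C = {x}" using assms(3) by (auto simp: card_1_singleton_iff)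
  then have "orbit w x = {x}" using orbits_eq_orbit[OF assms(1) V assms(2), of x] by simp
  then have "w x = x" by (simp only: orbit_eq_singleton_iff)
  then show ?thesis using \<open>C = {x}\<close> irrefl by (simp add: tails_def)
qed

text \<open>A sign-reversing involution: reversing one even cycle exchanges its factors
  \<open>1\<close> and \<open>-1\<close>, keeps a factor \<open>0\<close>, and leaves the other
  cycles alone.\<close>

lemma sum_cycle_sign_even_orbit:
  "(\<Sum>w | w permutes V \<and> (\<exists>C\<in>orbits w V. even (card C)). \<Prod>C\<in>orbits w V. cycle_sign (tails w) C) = 0"
proof -
  let ?E = "{w. w permutes V \<and> (\<exists>C\<in>orbits w V. even (card C))}"
  let ?h = "\<lambda>w. \<Prod>C\<in>orbits w V. cycle_sign (tails w) C"
  \<comment> \<open>The choice depends only on the set of orbits, which the reversal preserves, so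
    \<open>\<iota>\<close> is an involution.\<close>
  define even_orbit where "even_orbit \<C> = (SOME C. C \<in> \<C> \<and> even (card C))" for \<C> :: "'a set set"
  define \<iota> where "\<iota> w = reverse_on (even_orbit (orbits w V)) w" for w
  have main: "\<iota> w \<in> ?E \<and> \<iota> (\<iota> w) = w \<and> ?h (\<iota> w) = - ?h w" if "w \<in> ?E" for w
  proof -
    define C where "C = even_orbit (orbits w V)"
    have w: "w permutes V" using that by simp
    have C: "C \<in> orbits w V" "even (card C)"
      using someI_ex[of "\<lambda>C. C \<in> orbits w V \<and> even (card C)"] that
      unfolding C_def even_orbit_def by auto
    interpret invariant_subset w V C by (rule invariant_subset_orbit[OF w V C(1)])
    have \<iota>: "\<iota> w = reverse_on C w" by (simp add: \<iota>_def C_def)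
    have orb: "orbits (\<iota> w) V = orbits w V" by (simp add: \<iota> orbits_reverse_on)
    have "\<iota> (\<iota> w) = reverse_on C (\<iota> w)" by (simp add: \<iota>_def[of "\<iota> w"] orb C_def)
    then have "\<iota> (\<iota> w) = w" by (simp add: \<iota> reverse_on_reverse_on)
    moreover have "\<iota> w \<in> ?E" using that orb reverse_on_permutes \<iota> by simp
    moreover have "?h (\<iota> w) = - ?h w"
    proof -
      have fin: "finite (orbits w V)" using V by (simp add: orbits_def)
      have ne: "C \<noteq> {}" using C orbits_nonempty by blast
      have "finite C" using orbits_subset[OF w C(1)] V finite_subset by blast
      \<comment> \<open>As \<open>C\<close> is nonempty, the truncated subtraction is exact.\<close>
      then have "odd (card C - 1)" using C ne by (cases "card C") auto
      moreover have "card C \<noteq> 1" using C by auto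
      note reversed_orbit_tails[OF w C(1) this order.refl]
      \<comment> \<open>The two extreme cases of \<open>cycle_sign\<close> exclude each other, so
        swapping them respects the order of its case distinction.\<close>
      moreover have "\<not> (tails w \<inter> C = {} \<and> C \<subseteq> tails w)" using ne by blast
      ultimately have 1: "cycle_sign (tails (\<iota> w)) C = - cycle_sign (tails w) C"
        unfolding cycle_sign_def \<iota> by auto
      have "cycle_sign (tails (\<iota> w)) D = cycle_sign (tails w) D" if "D \<in> orbits w V - {C}" for D
      proof -
        have "D \<inter> C = {}" using that C disjoint_orbits[OF w V] by (auto simp: disjoint_def)
        then show ?thesis unfolding \<iota> by (intro cycle_sign_cong unreversed_orbit_tails)
      qed
      then have "(\<Prod>D\<in>orbits w V - {C}. cycle_sign (tails (\<iota> w)) D)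
          = (\<Prod>D\<in>orbits w V - {C}. cycle_sign (tails w) D)" by (rule prod.cong[OF refl])
      then show ?thesis unfolding orb using 1 by (simp add: prod.remove[OF fin C(1)])
    qed
    ultimately show ?thesis by blast
  qed
  have "sum ?h ?E = (\<Sum>w\<in>?E. - ?h w)"
    by (rule sum.reindex_bij_witness[where i = \<iota> and j = \<iota>]) (use main in auto)
  then show ?thesis by (simp add: sum_negf)
qed

section \<open>Odd cycles and the powers of two\<close>

definition nontrivial_orbits :: "('a \<Rightarrow> 'a) \<Rightarrow> 'a set set" where
  "nontrivial_orbits w = {C \<in> orbits w V. card C \<noteq> 1}"

definition odd_orbits :: "('a \<Rightarrow> 'a) \<Rightarrow> bool" where
  "odd_orbits w \<longleftrightarrow> (\<forall>C\<in>orbits w V. odd (card C))"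

text \<open>The permutations with an even cycle cancel. For the others each exponent
  \<open>card C - 1\<close> is even, so every factor is \<open>0\<close> or \<open>1\<close> and the
  product is an indicator.\<close>

lemma card_lists_avoiding_eq_card_odd:
  "card {xs \<in> permutations_of_set V. consec xs \<inter> B = {}}
    = card {w. w permutes V \<and> odd_orbits w \<and> (\<forall>C\<in>orbits w V. tails w \<inter> C = {} \<or> C \<subseteq> tails w)}"
proof -
  let ?h = "\<lambda>w. \<Prod>C\<in>orbits w V. cycle_sign (tails w) C"
  let ?W = "{w. w permutes V}"
  have fin: "finite ?W" using V by (rule finite_permutations)
  have "int (card {xs \<in> permutations_of_set V. consec xs \<inter> B = {}}) = sum ?h ?W"
    using card_lists_avoiding_eq_sum_cycle_sign[OF V B] by (simp add: tails_def)
  also have "\<dots> = sum ?h {w \<in> ?W. odd_orbits w} + sum ?h {w \<in> ?W. \<not> odd_orbits w}"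
  proof -
    have "?W = {w \<in> ?W. odd_orbits w} \<union> {w \<in> ?W. \<not> odd_orbits w}" by blast
    then have "sum ?h ?W = sum ?h ({w \<in> ?W. odd_orbits w} \<union> {w \<in> ?W. \<not> odd_orbits w})"
      by (rule arg_cong)
    also have "\<dots> = sum ?h {w \<in> ?W. odd_orbits w} + sum ?h {w \<in> ?W. \<not> odd_orbits w}"
      using fin by (intro sum.union_disjoint) auto
    finally show ?thesis .
  qed
  also have "{w \<in> ?W. \<not> odd_orbits w} = {w. w permutes V \<and> (\<exists>C\<in>orbits w V. even (card C))}"
    by (auto simp: odd_orbits_def)
  also have "sum ?h \<dots> = 0" by (rule sum_cycle_sign_even_orbit)
  also have "sum ?h {w \<in> ?W. odd_orbits w} = (\<Sum>w\<in>{w \<in> ?W. odd_orbits w}.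
      if \<forall>C\<in>orbits w V. tails w \<inter> C = {} \<or> C \<subseteq> tails w then 1 else 0)"
  proof (rule sum.cong[OF refl])
    fix w assume w: "w \<in> {w \<in> ?W. odd_orbits w}"
    have "finite (orbits w V)" using V by (simp add: orbits_def)
    moreover have "cycle_sign (tails w) C = (if tails w \<inter> C = {} \<or> C \<subseteq> tails w then 1 else 0)"
      if "C \<in> orbits w V" for C
      using that w unfolding odd_orbits_def cycle_sign_def by auto
    ultimately show "?h w = (if \<forall>C\<in>orbits w V. tails w \<inter> C = {} \<or> C \<subseteq> tails w then 1 else 0)"
      by (auto intro: prod.neutral prod_zero)
  qed
  also have "\<dots> = int (card {w. w permutes V \<and> odd_orbits w
      \<and> (\<forall>C\<in>orbits w V. tails w \<inter> C = {} \<or> C \<subseteq> tails w)})"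
    using fin by (simp add: sum.If_cases Int_def conj_assoc)
  finally show ?thesis by simp
qed

text \<open>Reverse all nontrivial cycles without arcs in \<open>B\<close>. The result has all its
  nontrivial cycles in \<open>B\<close>, and any set of them may have been the reversed ones, hence
  the power of two.\<close>

lemma card_odd_eq_sum_nontrivial_orbits:
  "card {w. w permutes V \<and> odd_orbits w \<and> (\<forall>C\<in>orbits w V. tails w \<inter> C = {} \<or> C \<subseteq> tails w)}
    = (\<Sum>w | w permutes V \<and> odd_orbits w \<and> (\<forall>C\<in>nontrivial_orbits w. C \<subseteq> tails w).
        2 ^ card (nontrivial_orbits w))"
proof -
  let ?M = "{w. w permutes V \<and> odd_orbits w \<and> (\<forall>C\<in>orbits w V. tails w \<inter> C = {} \<or> C \<subseteq> tails w)}"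
  let ?G = "{w. w permutes V \<and> odd_orbits w \<and> (\<forall>C\<in>nontrivial_orbits w. C \<subseteq> tails w)}"
  define \<N> where "\<N> w = {C \<in> nontrivial_orbits w. tails w \<inter> C = {}}" for w
  have fin: "finite (nontrivial_orbits w)" for w
    using V by (simp add: nontrivial_orbits_def orbits_def)
  have "finite {w. w permutes V}" using V by (rule finite_permutations)
  then have finG: "finite ?G" by simp
  \<comment> \<open>The second component remembers which cycles were reversed, so that
    \<open>g\<close> can reverse them back.\<close>
  define f where "f w = (reverse_on (\<Union>(\<N> w)) w, \<N> w)" for w
  define g where "g p = reverse_on (\<Union>(snd p)) (fst p)" for p :: "('a \<Rightarrow> 'a) \<times> 'a set set"
  have bij: "bij_betw f ?M (SIGMA w:?G. Pow (nontrivial_orbits w))"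
  proof (rule bij_betw_byWitness[where f' = g])
    have rev_facts: "orbits (reverse_on (\<Union>\<A>) w) V = orbits w V"
      "nontrivial_orbits (reverse_on (\<Union>\<A>) w) = nontrivial_orbits w"
      "odd_orbits (reverse_on (\<Union>\<A>) w) = odd_orbits w"
      "reverse_on (\<Union>\<A>) w permutes V" "reverse_on (\<Union>\<A>) (reverse_on (\<Union>\<A>) w) = w"
      if "w permutes V" "\<A> \<subseteq> nontrivial_orbits w" for w \<A>
    proof -
      interpret invariant_subset w V "\<Union>\<A>"
        using that by (intro invariant_subset_Union_orbits V) (auto simp: nontrivial_orbits_def)
      show "orbits (reverse_on (\<Union>\<A>) w) V = orbits w V"
      "nontrivial_orbits (reverse_on (\<Union>\<A>) w) = nontrivial_orbits w"
      "odd_orbits (reverse_on (\<Union>\<A>) w) = odd_orbits w"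
      "reverse_on (\<Union>\<A>) w permutes V" "reverse_on (\<Union>\<A>) (reverse_on (\<Union>\<A>) w) = w"
        using reverse_on_permutes reverse_on_reverse_on
        by (auto simp: orbits_reverse_on nontrivial_orbits_def odd_orbits_def)
    qed
    have outside: "C \<inter> \<Union>\<A> = {}"
      if "w permutes V" "\<A> \<subseteq> nontrivial_orbits w" "C \<in> orbits w V" "C \<notin> \<A>" for w \<A> C
    proof -
      have "C \<inter> D = {}" if "D \<in> \<A>" for D
      proof (rule disjointD[OF disjoint_orbits[OF \<open>w permutes V\<close> V]])
        show "D \<in> orbits w V" using that \<open>\<A> \<subseteq> _\<close> by (auto simp: nontrivial_orbits_def)
      qed (use that \<open>C \<in> _\<close> \<open>C \<notin> \<A>\<close> in auto)
      then show ?thesis by blast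
    qed
    have \<N>: "\<N> w \<subseteq> nontrivial_orbits w" for w by (auto simp: \<N>_def)
    show "\<forall>w\<in>?M. g (f w) = w"
      using rev_facts(5) \<N> by (simp add: f_def g_def)
    show "f ` ?M \<subseteq> (SIGMA w:?G. Pow (nontrivial_orbits w))"
    proof (rule image_subsetI)
      fix w assume "w \<in> ?M"
      then have w: "w permutes V" "odd_orbits w"
        and M: "\<And>C. C \<in> orbits w V \<Longrightarrow> tails w \<inter> C = {} \<or> C \<subseteq> tails w" by auto
      have "C \<subseteq> tails (reverse_on (\<Union>(\<N> w)) w)" if C: "C \<in> nontrivial_orbits w" for C
      proof (cases "C \<in> \<N> w")
        case True
        then show ?thesis using reversed_orbit_tails(2)[OF w(1), of C "\<Union>(\<N> w)"] C
          by (auto simp: \<N>_def nontrivial_orbits_def)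
      next
        case False
        have C': "C \<in> orbits w V" using C by (simp add: nontrivial_orbits_def)
        then have "C \<subseteq> tails w" using M[OF C'] False C by (auto simp: \<N>_def)
        then show ?thesis
          using unreversed_orbit_tails[OF outside[OF w(1) \<N> C' False], of w] by blast
      qed
      then show "f w \<in> (SIGMA w:?G. Pow (nontrivial_orbits w))"
        using rev_facts[OF w(1) \<N>] w \<N> unfolding f_def by auto
    qed
    \<comment> \<open>After the reversal, the nontrivial cycles without arcs in \<open>B\<close> are
      exactly those in \<open>\<A>\<close>, so the recorded set can be read off.\<close>
    have G: "reverse_on (\<Union>\<A>) w \<in> ?M \<and> \<N> (reverse_on (\<Union>\<A>) w) = \<A>"
      if "w \<in> ?G" "\<A> \<subseteq> nontrivial_orbits w" for w \<A>
    proof -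
      have w: "w permutes V" "odd_orbits w"
        and nt: "\<And>C. C \<in> nontrivial_orbits w \<Longrightarrow> C \<subseteq> tails w" using that by auto
      let ?w = "reverse_on (\<Union>\<A>) w"
      note rev_facts = rev_facts[OF w(1) that(2)]
      have in_\<A>: "tails ?w \<inter> C = {}" if "C \<in> \<A>" for C
        using reversed_orbit_tails(1)[OF w(1), of C "\<Union>\<A>"] nt that \<open>\<A> \<subseteq> _\<close>
        by (auto simp: nontrivial_orbits_def)
      have notin_\<A>: "C \<subseteq> tails ?w" if "C \<in> nontrivial_orbits w" "C \<notin> \<A>" for C
        using unreversed_orbit_tails[OF outside[OF w(1) \<open>\<A> \<subseteq> _\<close> _ that(2)], of w] nt that
        by (auto simp: nontrivial_orbits_def)
      have triv: "tails ?w \<inter> C = {}" if "C \<in> orbits w V" "C \<notin> nontrivial_orbits w" for C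
        using trivial_orbit_tails[OF rev_facts(4)] that rev_facts(1) by (auto simp: nontrivial_orbits_def)
      have "\<N> ?w = \<A>"
      proof
        show "\<A> \<subseteq> \<N> ?w" using in_\<A> \<open>\<A> \<subseteq> _\<close> unfolding \<N>_def rev_facts(2) by blast
        show "\<N> ?w \<subseteq> \<A>"
        proof
          fix C assume C: "C \<in> \<N> ?w"
          then have "C \<in> nontrivial_orbits w" "tails ?w \<inter> C = {}" unfolding \<N>_def rev_facts(2) by auto
          \<comment> \<open>Only the empty set could be both contained in the tails and disjoint
            from them.\<close>
          moreover from this have "C \<noteq> {}" using orbits_nonempty by (auto simp: nontrivial_orbits_def)
          ultimately show "C \<in> \<A>" using notin_\<A> by blast
        qed
      qed
      moreover have "?w \<in> ?M"
        using rev_facts w in_\<A> notin_\<A> triv by (simp) blast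
      ultimately show ?thesis by blast
    qed
    show "g ` (SIGMA w:?G. Pow (nontrivial_orbits w)) \<subseteq> ?M"
    proof (rule image_subsetI)
      fix p assume "p \<in> (SIGMA w:?G. Pow (nontrivial_orbits w))"
      then obtain w \<A> where p: "p = (w, \<A>)" "w \<in> ?G" "\<A> \<subseteq> nontrivial_orbits w" by blast
      have "g p = reverse_on (\<Union>\<A>) w" by (simp add: g_def p(1))
      then show "g p \<in> ?M" using G[OF p(2,3)] by (simp only:)
    qed
    show "\<forall>p\<in>SIGMA w:?G. Pow (nontrivial_orbits w). f (g p) = p"
    proof
      fix p assume "p \<in> (SIGMA w:?G. Pow (nontrivial_orbits w))"
      then obtain w \<A> where p: "p = (w, \<A>)" "w \<in> ?G" "\<A> \<subseteq> nontrivial_orbits w" by blast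
      then show "f (g p) = p"
        using conjunct2[OF G[OF p(2,3)]] rev_facts(5)[of w \<A>] by (simp add: f_def g_def)
    qed
  qed
  have "card ?M = card (SIGMA w:?G. Pow (nontrivial_orbits w))"
    using bij by (rule bij_betw_same_card)
  also have "\<dots> = (\<Sum>w\<in>?G. card (Pow (nontrivial_orbits w)))"
    using finG fin by (intro card_SigmaI) auto
  finally show ?thesis using fin by (simp only: card_Pow)
qed

end

section \<open>Cycles as lists\<close>

lemma perm_cycle_set_eq_orbit:
  assumes w: "permutation w" and vs: "perm_cycle w vs" and x: "x \<in> set vs"
  shows "set vs = orbit w x"
proof -
  obtain i where i: "i < length vs" "x = vs ! i" using x by (metis in_set_conv_nth)
  have orb: "orbit w x = range (\<lambda>k. vs ! ((i + k) mod length vs))"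
    using perm_cycle_funpow[OF vs i(1)] i(2) by (auto simp: orbit_altdef_permutation[OF w])
  show ?thesis
  proof
    show "orbit w x \<subseteq> set vs" unfolding orb using i(1) by (auto intro!: nth_mem mod_less_divisor)
    show "set vs \<subseteq> orbit w x"
    proof
      fix y assume "y \<in> set vs"
      then obtain j where j: "j < length vs" "y = vs ! j" by (metis in_set_conv_nth)
      \<comment> \<open>Going from position \<open>i\<close> to \<open>j\<close> past the end of the
        list avoids the truncated difference \<open>j - i\<close>.\<close>
      have "(i + (length vs - i + j)) mod length vs = j" using i j by simp
      then show "y \<in> orbit w x" unfolding orb using j by (metis rangeI)
    qed
  qed
qed

lemma perm_cycle_card: "perm_cycle w vs \<Longrightarrow> card (set vs) = length vs"
  by (simp add: perm_cycle_def distinct_card)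

lemma orbit_perm_cycle:
  assumes "permutation w"
  obtains vs where "perm_cycle w vs" "set vs = orbit w x"
proof
  show "perm_cycle w (support w x)" by (rule perm_cycle_support[OF assms])
  show "set (support w x) = orbit w x"
    using support_set[OF assms, of x] orbit_altdef_permutation[OF assms, of x] by auto
qed

text \<open>A one-element list of a point outside \<open>V\<close> is a \<open>perm_cycle\<close> as
  well; asking that the list meet \<open>V\<close> excludes it.\<close>

lemma orbits_eq_perm_cycles:
  assumes "w permutes V" "finite V"
  shows "orbits w V = {set vs | vs. perm_cycle w vs \<and> set vs \<inter> V \<noteq> {}}"
proof -
  have pw: "permutation w" using assms permutation_permutes by blast
  have "\<exists>vs. orbit w x = set vs \<and> perm_cycle w vs \<and> set vs \<inter> V \<noteq> {}" if "x \<in> V" for x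
  proof -
    obtain vs where "perm_cycle w vs" "set vs = orbit w x" using orbit_perm_cycle[OF pw] .
    then show ?thesis using that self_in_orbit_permutes[OF assms, of x] by blast
  qed
  moreover have "set vs \<in> orbit w ` V" if vs: "perm_cycle w vs" and "set vs \<inter> V \<noteq> {}" for vs
  proof -
    obtain x where "x \<in> set vs" "x \<in> V" using \<open>set vs \<inter> V \<noteq> {}\<close> by blast
    then show ?thesis using perm_cycle_set_eq_orbit[OF pw vs] by blast
  qed
  ultimately show ?thesis unfolding orbits_def by blast
qed

text \<open>Cycle lists range over the whole type. Outside \<open>V\<close> they are fixed points,
  hence neither nontrivial nor of even length.\<close>

lemma perm_cycle_outside:
  assumes "w permutes V" "finite V" "perm_cycle w vs" "set vs \<inter> V = {}"
  shows "length vs = 1"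
proof -
  have pw: "permutation w" using assms permutation_permutes by blast
  obtain x where x: "x \<in> set vs" using assms(3) by (cases vs) (auto simp: perm_cycle_def)
  then have "w x = x" using assms permutes_not_in[OF assms(1)] by blast
  then have "set vs = {x}" using perm_cycle_set_eq_orbit[OF pw assms(3) x] orbit_eq_singleton_iff by metis
  then show ?thesis using perm_cycle_card[OF assms(3)] by simp
qed

context tournament_arcs
begin

text \<open>The rotations of a cycle list share one set of entries, namely the orbit, so
  \<open>nsc\<close> counts each cycle once.\<close>

lemma nontrivial_cycles:
  assumes "w permutes V"
  shows "{set vs | vs. nontrivial_cycle w vs} = nontrivial_orbits w"
proof -
  have "nontrivial_cycle w vs \<longleftrightarrow> perm_cycle w vs \<and> set vs \<inter> V \<noteq> {} \<and> card (set vs) \<noteq> 1" for vs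
  proof -
    have "length vs \<ge> 2 \<longleftrightarrow> length vs \<noteq> 1" if "perm_cycle w vs"
    proof -
      have "length vs \<noteq> 0" using that by (simp add: perm_cycle_def)
      then show ?thesis by linarith
    qed
    then show ?thesis
      using perm_cycle_outside[OF assms V, of vs] perm_cycle_card[of w vs]
      unfolding nontrivial_cycle_def by metis
  qed
  then show ?thesis unfolding nontrivial_orbits_def orbits_eq_perm_cycles[OF assms V] by auto
qed

lemma nsc_eq_card_nontrivial_orbits: "w permutes V \<Longrightarrow> nsc w = card (nontrivial_orbits w)"
  by (simp add: nsc_def nontrivial_cycles)

lemma odd_orbits_iff:
  assumes "w permutes V"
  shows "odd_orbits w \<longleftrightarrow> (\<forall>vs. perm_cycle w vs \<longrightarrow> odd (length vs))"
proof -
  have "odd (length vs)" if "perm_cycle w vs" "set vs \<inter> V = {}" for vs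
    using perm_cycle_outside[OF assms V that] by simp
  then show ?thesis
    unfolding odd_orbits_def orbits_eq_perm_cycles[OF assms V] using perm_cycle_card by fastforce
qed

lemma directed_cycle_iff_tails:
  assumes "perm_cycle w vs" "parcs D = B"
  shows "directed_cycle D vs \<longleftrightarrow> set vs \<subseteq> tails w"
  using assms unfolding directed_cycle_def perm_cycle_def tails_def
  by (auto simp: in_set_conv_nth subset_iff)

lemma all_directed_cycles_iff:
  assumes "w permutes V" "parcs D = B"
  shows "(\<forall>vs. nontrivial_cycle w vs \<longrightarrow> directed_cycle D vs)
    \<longleftrightarrow> (\<forall>C\<in>nontrivial_orbits w. C \<subseteq> tails w)"
  unfolding nontrivial_cycles[OF assms(1), symmetric]
  using directed_cycle_iff_tails[OF _ assms(2), of w] unfolding nontrivial_cycle_def by blast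

end

section \<open>One-line notation\<close>

text \<open>Injective because a permutation of \<open>{1..n}\<close> is the identity elsewhere; onto
  because both sets have the same cardinality.\<close>

lemma bij_betw_one_line:
  "bij_betw (\<lambda>p. map p [1..<Suc n]) {p. p permutes {1..n}} (permutations_of_set {1..n})"
proof -
  let ?f = "\<lambda>p :: nat \<Rightarrow> nat. map p [1..<Suc n]"
  have inj: "inj_on ?f {p. p permutes {1..n}}"
  proof (rule inj_onI)
    fix p q assume "p \<in> {p. p permutes {1..n}}" "q \<in> {p. p permutes {1..n}}" "?f p = ?f q"
    then have pq: "p permutes {1..n}" "q permutes {1..n}" "\<forall>x\<in>{1..n}. p x = q x"
      by (auto simp del: upt_Suc)
    then show "p = q" by (metis ext permutes_not_in)
  qed
  have "?f ` {p. p permutes {1..n}} \<subseteq> permutations_of_set {1..n}"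
  proof clarify
    fix p assume p: "p permutes {1..n}"
    have "set [1..<Suc n] = {1..n}" by auto
    then show "?f p \<in> permutations_of_set {1..n}"
      using permutes_image[OF p] permutes_inj_on[OF p]
      by (intro permutations_of_setI) (simp_all add: distinct_map del: upt_Suc)
  qed
  moreover have "card (?f ` {p. p permutes {1..n}}) = card (permutations_of_set {1..n})"
    using card_image[OF inj] by (simp add: card_permutations)
  ultimately have "?f ` {p. p permutes {1..n}} = permutations_of_set {1..n}"
    by (intro card_subset_eq) auto
  then show ?thesis using inj by (simp add: bij_betw_def)
qed

lemma consec_one_line: "consec (map p [1..<Suc n]) = (\<lambda>i. (p i, p (i + 1))) ` {1..n - 1}"
proof -
  \<comment> \<open>List indices start at 0, positions in one-line notation at 1.\<close>
  have "{1..n - 1} = Suc ` {..<n - 1}" by (auto simp: image_Suc_lessThan)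
  moreover have "map p [1..<Suc n] ! i = p (Suc i)" if "i < n" for i
    using that by (simp del: upt_Suc)
  ultimately show ?thesis
    unfolding consec_conv_nth by (auto simp: image_image simp del: upt_Suc intro!: image_cong)
qed

lemma card_Collect_bij_betw:
  assumes "bij_betw f A B"
  shows "card {x \<in> A. P (f x)} = card {y \<in> B. P y}"
proof (rule bij_betw_same_card)
  show "bij_betw f {x \<in> A. P (f x)} {y \<in> B. P y}"
    using assms by (auto simp: bij_betw_def inj_on_def)
qed

text \<open>Adjacent entries of a permutation are distinct elements of \<open>{1..n}\<close>, so
  \<open>X\<close> may be restricted to such pairs.\<close>

lemma d_num_empty_eq_card_lists:
  "d_num X {} n = card {xs \<in> permutations_of_set {1..n}.
    consec xs \<inter> {(i, j). i \<in> {1..n} \<and> j \<in> {1..n} \<and> i \<noteq> j \<and> (i, j) \<in> X} = {}}"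
    (is "_ = card {xs \<in> ?L. consec xs \<inter> ?B = {}}")
proof -
  let ?f = "\<lambda>p :: nat \<Rightarrow> nat. map p [1..<Suc n]"
  have "XDes X n p = {} \<longleftrightarrow> consec (?f p) \<inter> ?B = {}" if p: "p permutes {1..n}" for p
  proof -
    have "(p i, p (i + 1)) \<in> X \<longleftrightarrow> (p i, p (i + 1)) \<in> ?B" if "i \<in> {1..n - 1}" for i
    proof -
      have "p i \<in> {1..n}" "p (i + 1) \<in> {1..n}" "p i \<noteq> p (i + 1)"
        using that permutes_in_image[OF p] permutes_inj[OF p] by (auto dest: injD)
      then show ?thesis by simp
    qed
    then show ?thesis unfolding consec_one_line XDes_def by blast
  qed
  then have "{p. p permutes {1..n} \<and> XDes X n p = {}}
      = {p \<in> {p. p permutes {1..n}}. consec (?f p) \<inter> ?B = {}}" by blast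
  then show ?thesis
    unfolding d_num_def
    by (simp only: card_Collect_bij_betw[OF bij_betw_one_line, of n "\<lambda>xs. consec xs \<inter> ?B = {}"])
qed

text \<open>The digraph takes the complement of \<open>X\<close> and reversal swaps the pairs. In a
  tournament the two operations cancel on distinct vertices, so the reversed arcs are pairs of
  \<open>X\<close> itself.\<close>

lemma tournament_G_digraph:
  assumes "tournament (G_digraph n X)"
  defines "B \<equiv> {(i, j). i \<in> {1..n} \<and> j \<in> {1..n} \<and> i \<noteq> j \<and> (i, j) \<in> X}"
  shows "tournament_arcs {1..n} B" and "parcs (reverse_digraph (G_digraph n X)) = B"
proof -
  have flip: "(i, j) \<in> X \<longleftrightarrow> (j, i) \<notin> X" if "i \<in> {1..n}" "j \<in> {1..n}" "i \<noteq> j" for i j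
  proof -
    have "((i, j) \<in> parcs (G_digraph n X) \<and> (j, i) \<notin> parcs (G_digraph n X))
        \<or> ((i, j) \<notin> parcs (G_digraph n X) \<and> (j, i) \<in> parcs (G_digraph n X))"
      using assms(1) that unfolding tournament_def by (simp add: G_digraph_def)
    then show ?thesis using that by (auto simp: G_digraph_def)
  qed
  show "tournament_arcs {1..n} B"
  proof
    fix i j assume "i \<in> {1..n}" "j \<in> {1..n}" "i \<noteq> j"
    then show "(i, j) \<in> B \<longleftrightarrow> (j, i) \<notin> B" using flip[of i j] by (simp add: B_def)
  qed (auto simp: B_def)
  have "(i, j) \<in> parcs (reverse_digraph (G_digraph n X)) \<longleftrightarrow> (i, j) \<in> B" for i j
    using flip[of i j] by (simp add: B_def reverse_digraph_def G_digraph_def) blast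
  then show "parcs (reverse_digraph (G_digraph n X)) = B" by auto
qed

theorem theorem3p3:
  fixes X :: "(nat \<times> nat) set" and n :: nat
  assumes "\<forall>m. tournament (G_digraph m X)"
  shows "d_num X {} n =
    (\<Sum>w | w permutes {1..n} \<and> odd_order n w \<and>
        (\<forall>vs. nontrivial_cycle w vs \<longrightarrow> directed_cycle (reverse_digraph (G_digraph n X)) vs).
      2 ^ nsc w)"
proof -
  define B where "B = {(i, j). i \<in> {1..n} \<and> j \<in> {1..n} \<and> i \<noteq> j \<and> (i, j) \<in> X}"
  have t: "tournament (G_digraph n X)" using assms by blast
  interpret tournament_arcs "{1..n}" B unfolding B_def by (rule tournament_G_digraph(1)[OF t])
  have arcs: "parcs (reverse_digraph (G_digraph n X)) = B"
    unfolding B_def by (rule tournament_G_digraph(2)[OF t])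
  have "d_num X {} n = card {xs \<in> permutations_of_set {1..n}. consec xs \<inter> B = {}}"
    unfolding B_def by (rule d_num_empty_eq_card_lists)
  also have "\<dots> = (\<Sum>w | w permutes {1..n} \<and> odd_orbits w \<and> (\<forall>C\<in>nontrivial_orbits w. C \<subseteq> tails w).
      2 ^ card (nontrivial_orbits w))"
    unfolding card_lists_avoiding_eq_card_odd by (rule card_odd_eq_sum_nontrivial_orbits)
  also have "\<dots> = (\<Sum>w | w permutes {1..n} \<and> odd_order n w \<and>
        (\<forall>vs. nontrivial_cycle w vs \<longrightarrow> directed_cycle (reverse_digraph (G_digraph n X)) vs).
      2 ^ nsc w)"
  \<comment> \<open>What remains is a translation: odd orbits into odd order by way of cycle
    lengths, and orbits inside \<open>tails w\<close> into directed cycles.\<close>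
  proof (rule sum.cong)
    show "{w. w permutes {1..n} \<and> odd_orbits w \<and> (\<forall>C\<in>nontrivial_orbits w. C \<subseteq> tails w)}
      = {w. w permutes {1..n} \<and> odd_order n w \<and>
          (\<forall>vs. nontrivial_cycle w vs \<longrightarrow> directed_cycle (reverse_digraph (G_digraph n X)) vs)}"
      using odd_orbits_iff odd_order_iff_cycle_lengths[of _ n] all_directed_cycles_iff[OF _ arcs]
      by (intro Collect_cong) metis
  qed (simp add: nsc_eq_card_nontrivial_orbits)
  finally show ?thesis .
qed

end
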